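(* Both assignments $S\longmapsto \mathrm{rad}_m(S)$ and $S\longmapsto \mathrm{rad}_s(S)$ (from semirings $S$ to congruences on $S$) are Hoehnke radicals. That is, for $r=\mathrm{rad}_m$ and for $r=\mathrm{rad}_s$, and for every semiring $S$: (i) for every surjective semiring homomorphism $f:S\to f(S)$ one has $f(r(S))\subseteq r(f(S))$, where $f(r(S))=\{(f(a),f(b))\mid (a,b)\in r(S)\}$; and (ii) $r(S/r(S))=\Delta_{S/r(S)}$.
   Context: A semiring $(S,+,\cdot)$ is a set with $(S,+)$ a commutative monoid with identity $0$, $(S,\cdot)$ a semigroup (no multiplicative identity is assumed), multiplication distributing over addition on both sides, and $0s=s0=0$ for all $s$. Semiring homomorphisms preserve $+$, $\cdot$ and $0$. A congruence on $S$ is an equivalence relation $\rho$ such that $(a,b)\in\rho$ implies $(a+c,b+c),(ac,bc),(ca,cb)\in\rho$ for all $c\in S$. $\Delta_S=\{(s,s)\mid s\in S\}$ and $\nabla_S=S\times S$. An $S$-semimodule is a right $S$-semimodule: a commutative monoid $(M,+,0_M)$ with a map $M\times S\to M$ such that $(m_1+m_2)s=m_1s+m_2s$, $m(s_1+s_2)=ms_1+ms_2$, $m(s_1s_2)=(ms_1)s_2$, $m0=0_M=0_Ms$. An $S$-semimodule $M$ with $MS\neq 0$ (i.e. $ms\ne 0_M$ for some $m\in M,s\in S$) is called minimal if its only subsemimodules are $(0)$ and $M$; it is called simple if it is minimal and its only congruences (as an $S$-semimodule) are the equality relation $\Delta_M$ and $\nabla_M=M\times M$. The annihilator of $M$ is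 the congruence $\mathrm{ann}_S(M)=\{(s_1,s_2)\in S\times S\mid ms_1=ms_2 \text{ for all } m\in M\}$. $\mathrm{rad}_m(S)$ is the intersection of $\mathrm{ann}_S(M)$ over all minimal $S$-semimodules $M$, and $\mathrm{rad}_s(S)$ is the intersection of $\mathrm{ann}_S(M)$ over all simple $S$-semimodules $M$; if there are no minimal (resp. simple) $S$-semimodules, then $\mathrm{rad}_m(S)=\nabla_S$ (resp. $\mathrm{rad}_s(S)=\nabla_S$). *)

theory Defs
  imports "HOL-Algebra.Group"
begin

section \<open>Semirings without multiplicative identity\<close>

record 'a srng = "'a partial_object" +
  splus :: "['a, 'a] \<Rightarrow> 'a" (infixl "\<oplus>\<index>" 65)
  stimes :: "['a, 'a] \<Rightarrow> 'a" (infixl "\<odot>\<index>" 70)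
  szero :: 'a ("\<zero>\<index>")

locale srng =
  fixes S :: "'a srng" (structure)
  assumes plus_comm_monoid:
      "comm_monoid \<lparr>carrier = carrier S, monoid.mult = splus S, one = szero S\<rparr>"
    and times_closed: "\<lbrakk>a \<in> carrier S; b \<in> carrier S\<rbrakk> \<Longrightarrow> a \<odot> b \<in> carrier S"
    and times_assoc: "\<lbrakk>a \<in> carrier S; b \<in> carrier S; c \<in> carrier S\<rbrakk>
      \<Longrightarrow> (a \<odot> b) \<odot> c = a \<odot> (b \<odot> c)"
    and distrib_right: "\<lbrakk>a \<in> carrier S; b \<in> carrier S; c \<in> carrier S\<rbrakk>
      \<Longrightarrow> (a \<oplus> b) \<odot> c = a \<odot> c \<oplus> b \<odot> c"
    and distrib_left: "\<lbrakk>a \<in> carrier S; b \<in> carrier S; c \<in> carrier S\<rbrakk>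
      \<Longrightarrow> a \<odot> (b \<oplus> c) = a \<odot> b \<oplus> a \<odot> c"
    and zero_times: "a \<in> carrier S \<Longrightarrow> \<zero> \<odot> a = \<zero>"
    and times_zero: "a \<in> carrier S \<Longrightarrow> a \<odot> \<zero> = \<zero>"

definition srng_hom :: "'a srng \<Rightarrow> 'b srng \<Rightarrow> ('a \<Rightarrow> 'b) set" where
  "srng_hom S T = {f \<in> carrier S \<rightarrow> carrier T.
     (\<forall>a\<in>carrier S. \<forall>b\<in>carrier S. f (a \<oplus>\<^bsub>S\<^esub> b) = f a \<oplus>\<^bsub>T\<^esub> f b) \<and>
     (\<forall>a\<in>carrier S. \<forall>b\<in>carrier S. f (a \<odot>\<^bsub>S\<^esub> b) = f a \<odot>\<^bsub>T\<^esub> f b) \<and>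
     f \<zero>\<^bsub>S\<^esub> = \<zero>\<^bsub>T\<^esub>}"

definition srng_congruence :: "'a srng \<Rightarrow> 'a rel \<Rightarrow> bool" where
  "srng_congruence S \<rho> \<longleftrightarrow> equiv (carrier S) \<rho> \<and>
     (\<forall>(a, b)\<in>\<rho>. \<forall>c\<in>carrier S.
        (a \<oplus>\<^bsub>S\<^esub> c, b \<oplus>\<^bsub>S\<^esub> c) \<in> \<rho> \<and>
        (a \<odot>\<^bsub>S\<^esub> c, b \<odot>\<^bsub>S\<^esub> c) \<in> \<rho> \<and>
        (c \<odot>\<^bsub>S\<^esub> a, c \<odot>\<^bsub>S\<^esub> b) \<in> \<rho>)"

text \<open>The operations act on classes through arbitrary representatives: for a congruence, the
  union ranges over copies of a single class (see \<open>srng_quot_plus\<close>, \<open>srng_quot_times\<close> below).\<close>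

definition srng_quot :: "'a srng \<Rightarrow> 'a rel \<Rightarrow> 'a set srng" where
  "srng_quot S \<rho> =
     \<lparr>carrier = carrier S // \<rho>,
      splus = (\<lambda>A B. \<Union>a\<in>A. \<Union>b\<in>B. \<rho> `` {a \<oplus>\<^bsub>S\<^esub> b}),
      stimes = (\<lambda>A B. \<Union>a\<in>A. \<Union>b\<in>B. \<rho> `` {a \<odot>\<^bsub>S\<^esub> b}),
      szero = \<rho> `` {\<zero>\<^bsub>S\<^esub>}\<rparr>"

section \<open>Right semimodules\<close>

record ('a, 'm) smod = "'m partial_object" +
  mplus :: "['m, 'm] \<Rightarrow> 'm"
  mzero :: 'm
  act :: "['m, 'a] \<Rightarrow> 'm"

locale smod = srng S for S :: "'a srng" +
  fixes M :: "('a, 'm) smod"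
  assumes mplus_comm_monoid:
      "comm_monoid \<lparr>carrier = carrier M, monoid.mult = mplus M, one = mzero M\<rparr>"
    and act_closed: "\<lbrakk>m \<in> carrier M; s \<in> carrier S\<rbrakk> \<Longrightarrow> act M m s \<in> carrier M"
    and mplus_act: "\<lbrakk>m \<in> carrier M; n \<in> carrier M; s \<in> carrier S\<rbrakk>
      \<Longrightarrow> act M (mplus M m n) s = mplus M (act M m s) (act M n s)"
    and act_splus: "\<lbrakk>m \<in> carrier M; s \<in> carrier S; t \<in> carrier S\<rbrakk>
      \<Longrightarrow> act M m (s \<oplus>\<^bsub>S\<^esub> t) = mplus M (act M m s) (act M m t)"
    and act_stimes: "\<lbrakk>m \<in> carrier M; s \<in> carrier S; t \<in> carrier S\<rbrakk>
      \<Longrightarrow> act M m (s \<odot>\<^bsub>S\<^esub> t) = act M (act M m s) t"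
    and act_szero: "m \<in> carrier M \<Longrightarrow> act M m \<zero>\<^bsub>S\<^esub> = mzero M"
    and mzero_act: "s \<in> carrier S \<Longrightarrow> act M (mzero M) s = mzero M"

definition subsmod :: "'a srng \<Rightarrow> ('a, 'm) smod \<Rightarrow> 'm set \<Rightarrow> bool" where
  "subsmod S M N \<longleftrightarrow> N \<subseteq> carrier M \<and> mzero M \<in> N \<and>
     (\<forall>m\<in>N. \<forall>n\<in>N. mplus M m n \<in> N) \<and>
     (\<forall>m\<in>N. \<forall>s\<in>carrier S. act M m s \<in> N)"

definition smod_congruence :: "'a srng \<Rightarrow> ('a, 'm) smod \<Rightarrow> 'm rel \<Rightarrow> bool" where
  "smod_congruence S M \<theta> \<longleftrightarrow> equiv (carrier M) \<theta> \<and>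
     (\<forall>(m, n)\<in>\<theta>. \<forall>p\<in>carrier M. (mplus M m p, mplus M n p) \<in> \<theta>) \<and>
     (\<forall>(m, n)\<in>\<theta>. \<forall>s\<in>carrier S. (act M m s, act M n s) \<in> \<theta>)"

definition minimal_smod :: "'a srng \<Rightarrow> ('a, 'm) smod \<Rightarrow> bool" where
  "minimal_smod S M \<longleftrightarrow> smod S M \<and>
     (\<exists>m\<in>carrier M. \<exists>s\<in>carrier S. act M m s \<noteq> mzero M) \<and>
     (\<forall>N. subsmod S M N \<longrightarrow> N = {mzero M} \<or> N = carrier M)"

definition simple_smod :: "'a srng \<Rightarrow> ('a, 'm) smod \<Rightarrow> bool" where
  "simple_smod S M \<longleftrightarrow> minimal_smod S M \<and>
     (\<forall>\<theta>. smod_congruence S M \<theta> \<longrightarrow> \<theta> = Id_on (carrier M) \<or> \<theta> = carrier M \<times> carrier M)"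

definition ann :: "'a srng \<Rightarrow> ('a, 'm) smod \<Rightarrow> 'a rel" where
  "ann S M = {(s, t) \<in> carrier S \<times> carrier S. \<forall>m\<in>carrier M. act M m s = act M m t}"

section \<open>The two radicals\<close>

text \<open>A HOL definition can only range over the semimodules on one fixed type. Here it is the
  element type of the semiring. This loses nothing: a minimal semimodule \<open>M\<close> has an \<open>m\<close> with
  \<open>mS = M\<close>, so it has an isomorphic copy on that type, and \<open>rad_m_subset_ann\<close> and
  \<open>rad_s_subset_ann\<close> below show that the radicals lie in the annihilators of the minimal
  (simple) semimodules on every type. When there are none, the intersection with
  \<open>carrier S \<times> carrier S\<close> gives the full relation.\<close>

definition rad_m :: "'a srng \<Rightarrow> 'a rel" where
  "rad_m S = (carrier S \<times> carrier S) \<inter>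
     (\<Inter>M \<in> {M :: ('a, 'a) smod. minimal_smod S M}. ann S M)"

definition rad_s :: "'a srng \<Rightarrow> 'a rel" where
  "rad_s S = (carrier S \<times> carrier S) \<inter>
     (\<Inter>M \<in> {M :: ('a, 'a) smod. simple_smod S M}. ann S M)"

section \<open>Well-definedness of the quotient operations\<close>

lemma srng_plus_closed:
  assumes "srng S" "a \<in> carrier S" "b \<in> carrier S"
  shows "a \<oplus>\<^bsub>S\<^esub> b \<in> carrier S"
  using monoid.m_closed[OF comm_monoid.axioms(1)[OF srng.plus_comm_monoid[OF assms(1)]]] assms
  by simp

lemma srng_plus_comm:
  assumes "srng S" "a \<in> carrier S" "b \<in> carrier S"
  shows "a \<oplus>\<^bsub>S\<^esub> b = b \<oplus>\<^bsub>S\<^esub> a"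
  using comm_monoid.m_comm[OF srng.plus_comm_monoid[OF assms(1)]] assms by simp

lemma srng_congruence_plus:
  assumes "srng S" "srng_congruence S \<rho>" "(a, a') \<in> \<rho>" "(b, b') \<in> \<rho>"
  shows "(a \<oplus>\<^bsub>S\<^esub> b, a' \<oplus>\<^bsub>S\<^esub> b') \<in> \<rho>"
proof -
  have eq: "equiv (carrier S) \<rho>" using assms(2) by (simp add: srng_congruence_def)
  then have c: "a \<in> carrier S" "a' \<in> carrier S" "b \<in> carrier S" "b' \<in> carrier S"
    using assms(3,4) by (auto simp: equiv_def)
  have "(a \<oplus>\<^bsub>S\<^esub> b, a' \<oplus>\<^bsub>S\<^esub> b) \<in> \<rho>" "(b \<oplus>\<^bsub>S\<^esub> a', b' \<oplus>\<^bsub>S\<^esub> a') \<in> \<rho>"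
    using assms(2-4) c unfolding srng_congruence_def by fast+
  then show ?thesis
    using eq srng_plus_comm[OF assms(1)] c unfolding equiv_def by (metis transD)
qed

lemma srng_congruence_times:
  assumes "srng_congruence S \<rho>" "(a, a') \<in> \<rho>" "(b, b') \<in> \<rho>"
  shows "(a \<odot>\<^bsub>S\<^esub> b, a' \<odot>\<^bsub>S\<^esub> b') \<in> \<rho>"
proof -
  have eq: "equiv (carrier S) \<rho>" using assms(1) by (simp add: srng_congruence_def)
  then have c: "a' \<in> carrier S" "b \<in> carrier S"
    using assms(2,3) by (auto simp: equiv_def)
  have "(a \<odot>\<^bsub>S\<^esub> b, a' \<odot>\<^bsub>S\<^esub> b) \<in> \<rho>" "(a' \<odot>\<^bsub>S\<^esub> b, a' \<odot>\<^bsub>S\<^esub> b') \<in> \<rho>"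
    using assms c unfolding srng_congruence_def by fast+
  then show ?thesis
    using eq unfolding equiv_def by (metis transD)
qed

lemma srng_quot_plus:
  assumes "srng S" "srng_congruence S \<rho>" "a \<in> carrier S" "b \<in> carrier S"
  shows "\<rho> `` {a} \<oplus>\<^bsub>srng_quot S \<rho>\<^esub> \<rho> `` {b} = \<rho> `` {a \<oplus>\<^bsub>S\<^esub> b}"
proof -
  have eq: "equiv (carrier S) \<rho>" using assms(2) by (simp add: srng_congruence_def)
  have *: "\<rho> `` {x \<oplus>\<^bsub>S\<^esub> y} = \<rho> `` {a \<oplus>\<^bsub>S\<^esub> b}" if "x \<in> \<rho> `` {a}" "y \<in> \<rho> `` {b}" for x y
    using equiv_class_eq[OF eq srng_congruence_plus[OF assms(1,2)]] that by blast
  have ne: "a \<in> \<rho> `` {a}" "b \<in> \<rho> `` {b}"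
    using equiv_class_self[OF eq] assms(3,4) by auto
  have "(\<Union>x\<in>\<rho> `` {a}. \<Union>y\<in>\<rho> `` {b}. \<rho> `` {x \<oplus>\<^bsub>S\<^esub> y}) =
      (\<Union>x\<in>\<rho> `` {a}. \<Union>y\<in>\<rho> `` {b}. \<rho> `` {a \<oplus>\<^bsub>S\<^esub> b})"
    by (intro SUP_cong refl *)
  also have "\<dots> = \<rho> `` {a \<oplus>\<^bsub>S\<^esub> b}" using ne by blast
  finally show ?thesis by (simp add: srng_quot_def)
qed

lemma srng_quot_times:
  assumes "srng_congruence S \<rho>" "a \<in> carrier S" "b \<in> carrier S"
  shows "\<rho> `` {a} \<odot>\<^bsub>srng_quot S \<rho>\<^esub> \<rho> `` {b} = \<rho> `` {a \<odot>\<^bsub>S\<^esub> b}"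
proof -
  have eq: "equiv (carrier S) \<rho>" using assms(1) by (simp add: srng_congruence_def)
  have *: "\<rho> `` {x \<odot>\<^bsub>S\<^esub> y} = \<rho> `` {a \<odot>\<^bsub>S\<^esub> b}" if "x \<in> \<rho> `` {a}" "y \<in> \<rho> `` {b}" for x y
    using equiv_class_eq[OF eq srng_congruence_times[OF assms(1)]] that by blast
  have ne: "a \<in> \<rho> `` {a}" "b \<in> \<rho> `` {b}"
    using equiv_class_self[OF eq] assms(2,3) by auto
  have "(\<Union>x\<in>\<rho> `` {a}. \<Union>y\<in>\<rho> `` {b}. \<rho> `` {x \<odot>\<^bsub>S\<^esub> y}) =
      (\<Union>x\<in>\<rho> `` {a}. \<Union>y\<in>\<rho> `` {b}. \<rho> `` {a \<odot>\<^bsub>S\<^esub> b})"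
    by (intro SUP_cong refl *)
  also have "\<dots> = \<rho> `` {a \<odot>\<^bsub>S\<^esub> b}" using ne by blast
  finally show ?thesis by (simp add: srng_quot_def)
qed

section \<open>Independence of the type of the semimodules\<close>

definition smod_iso :: "'a srng \<Rightarrow> ('a, 'm) smod \<Rightarrow> ('a, 'n) smod \<Rightarrow> ('m \<Rightarrow> 'n) \<Rightarrow> bool" where
  "smod_iso S M N g \<longleftrightarrow> bij_betw g (carrier M) (carrier N) \<and>
     (\<forall>m\<in>carrier M. \<forall>n\<in>carrier M. g (mplus M m n) = mplus N (g m) (g n)) \<and>
     g (mzero M) = mzero N \<and>
     (\<forall>m\<in>carrier M. \<forall>s\<in>carrier S. g (act M m s) = act N (g m) s)"

lemma smod_plus_closed:
  assumes "smod S M" "m \<in> carrier M" "n \<in> carrier M"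
  shows "mplus M m n \<in> carrier M"
  using monoid.m_closed[OF comm_monoid.axioms(1)[OF smod.mplus_comm_monoid[OF assms(1)]]] assms
  by simp

lemma smod_zero_closed: "smod S M \<Longrightarrow> mzero M \<in> carrier M"
  using monoid.one_closed[OF comm_monoid.axioms(1)[OF smod.mplus_comm_monoid]] by fastforce

lemma smod_plus_assoc:
  assumes "smod S M" "m \<in> carrier M" "n \<in> carrier M" "p \<in> carrier M"
  shows "mplus M (mplus M m n) p = mplus M m (mplus M n p)"
  using monoid.m_assoc[OF comm_monoid.axioms(1)[OF smod.mplus_comm_monoid[OF assms(1)]]] assms
  by simp

lemma smod_plus_comm:
  assumes "smod S M" "m \<in> carrier M" "n \<in> carrier M"
  shows "mplus M m n = mplus M n m"
  using comm_monoid.m_comm[OF smod.mplus_comm_monoid[OF assms(1)]] assms by simp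

lemma smod_zero_plus:
  assumes "smod S M" "m \<in> carrier M"
  shows "mplus M (mzero M) m = m"
  using monoid.l_one[OF comm_monoid.axioms(1)[OF smod.mplus_comm_monoid[OF assms(1)]]] assms
  by simp

lemma smod_iso_smod:
  assumes M: "smod S M" and g: "smod_iso S M N g"
  shows "smod S N"
proof -
  interpret smod S M by (rule M)
  have im: "carrier N = g ` carrier M" using g by (simp add: smod_iso_def bij_betw_def)
  have gz: "mzero N = g (mzero M)" using g by (simp add: smod_iso_def)
  have gp: "mplus N (g m) (g n) = g (mplus M m n)" if "m \<in> carrier M" "n \<in> carrier M" for m n
    using g that by (simp add: smod_iso_def)
  have ga: "act N (g m) s = g (act M m s)" if "m \<in> carrier M" "s \<in> carrier S" for m s
    using g that by (simp add: smod_iso_def)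
  note cl = smod_plus_closed[OF M] smod_zero_closed[OF M] act_closed
  have cm: "comm_monoid \<lparr>carrier = carrier N, monoid.mult = mplus N, one = mzero N\<rparr>"
  proof (rule comm_monoidI, goal_cases)
    case (5 x y)
    then show ?case using smod_plus_comm[OF M] by (auto simp: im gp)
  qed (auto simp: im gz gp cl smod_plus_assoc[OF M] smod_zero_plus[OF M])
  show ?thesis
    by (intro smod.intro srng_axioms smod_axioms.intro cm)
      (auto simp: im gz gp ga cl mplus_act act_splus act_stimes act_szero mzero_act
        plus_comm_monoid times_closed srng_plus_closed[OF srng_axioms]
        monoid.one_closed[OF comm_monoid.axioms(1)[OF plus_comm_monoid], simplified])
qed

lemma smod_iso_minimal:
  assumes M: "minimal_smod S M" and g: "smod_iso S M N g"
  shows "minimal_smod S N"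
proof -
  have sM: "smod S M" using M by (simp add: minimal_smod_def)
  interpret smod S M by (rule sM)
  have im: "carrier N = g ` carrier M" and inj: "inj_on g (carrier M)"
    using g by (simp_all add: smod_iso_def bij_betw_def)
  have gz: "mzero N = g (mzero M)" using g by (simp add: smod_iso_def)
  have gp: "mplus N (g m) (g n) = g (mplus M m n)" if "m \<in> carrier M" "n \<in> carrier M" for m n
    using g that by (simp add: smod_iso_def)
  have ga: "act N (g m) s = g (act M m s)" if "m \<in> carrier M" "s \<in> carrier S" for m s
    using g that by (simp add: smod_iso_def)
  obtain m s where ms: "m \<in> carrier M" "s \<in> carrier S" "act M m s \<noteq> mzero M"
    using M by (auto simp: minimal_smod_def)
  have "act N (g m) s \<noteq> mzero N"
    using ms inj act_closed smod_zero_closed[OF sM] by (auto simp: ga gz inj_on_def)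
  then have nz: "\<exists>m\<in>carrier N. \<exists>s\<in>carrier S. act N m s \<noteq> mzero N"
    using ms im by blast
  have "K = {mzero N} \<or> K = carrier N" if K: "subsmod S N K" for K
  proof -
    let ?L = "{m \<in> carrier M. g m \<in> K}"
    have "subsmod S M ?L"
      using K smod_plus_closed[OF sM] smod_zero_closed[OF sM] act_closed
      by (auto simp: subsmod_def gz simp flip: gp ga)
    then have "?L = {mzero M} \<or> ?L = carrier M" using M by (simp add: minimal_smod_def)
    moreover have "K = g ` ?L" using K im by (auto simp: subsmod_def)
    ultimately obtain L where "K = g ` L" "L = {mzero M} \<or> L = carrier M" by blast
    then show ?thesis using gz im by auto
  qed
  then show ?thesis using nz smod_iso_smod[OF sM g] by (simp add: minimal_smod_def)
qed

lemma smod_iso_simple: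
  assumes M: "simple_smod S M" and g: "smod_iso S M N g"
  shows "simple_smod S N"
proof -
  have mM: "minimal_smod S M" using M by (simp add: simple_smod_def)
  then have sM: "smod S M" by (simp add: minimal_smod_def)
  interpret smod S M by (rule sM)
  have im: "carrier N = g ` carrier M" and inj: "inj_on g (carrier M)"
    using g by (simp_all add: smod_iso_def bij_betw_def)
  have gp: "mplus N (g m) (g n) = g (mplus M m n)" if "m \<in> carrier M" "n \<in> carrier M" for m n
    using g that by (simp add: smod_iso_def)
  have ga: "act N (g m) s = g (act M m s)" if "m \<in> carrier M" "s \<in> carrier S" for m s
    using g that by (simp add: smod_iso_def)
  have "\<theta> = Id_on (carrier N) \<or> \<theta> = carrier N \<times> carrier N" if \<theta>: "smod_congruence S N \<theta>" for \<theta>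
  proof -
    let ?L = "{(m, n) \<in> carrier M \<times> carrier M. (g m, g n) \<in> \<theta>}"
    have eq: "equiv (carrier N) \<theta>" using \<theta> by (simp add: smod_congruence_def)
    have t1: "(mplus N m p, mplus N n p) \<in> \<theta>" if "(m, n) \<in> \<theta>" "p \<in> carrier N" for m n p
      using \<theta> that unfolding smod_congruence_def by blast
    have t2: "(act N m s, act N n s) \<in> \<theta>" if "(m, n) \<in> \<theta>" "s \<in> carrier S" for m n s
      using \<theta> that unfolding smod_congruence_def by blast
    have "equiv (carrier M) ?L"
    proof (rule equivI)
      show "refl_on (carrier M) ?L" using eq im by (auto simp: equiv_def refl_on_def)
      show "sym ?L" using eq by (auto simp: equiv_def intro!: symI dest: symD)
      show "trans ?L" using eq by (auto simp: equiv_def intro!: transI dest: transD)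
    qed auto
    then have "smod_congruence S M ?L"
      using t1 t2 im smod_plus_closed[OF sM] act_closed
      by (auto simp: smod_congruence_def simp flip: gp ga)
    then have "?L = Id_on (carrier M) \<or> ?L = carrier M \<times> carrier M"
      using M by (simp add: simple_smod_def)
    moreover have "\<theta> = map_prod g g ` ?L"
    proof
      show "\<theta> \<subseteq> map_prod g g ` ?L"
      proof
        fix x assume x: "x \<in> \<theta>"
        then have "x \<in> carrier N \<times> carrier N" using eq by (auto simp: equiv_def)
        then obtain m n where "m \<in> carrier M" "n \<in> carrier M" "x = (g m, g n)"
          using im by auto
        then show "x \<in> map_prod g g ` ?L" using x by force
      qed
    qed auto
    moreover have "map_prod g g ` Id_on (carrier M) = Id_on (carrier N)"
      using im by (force simp: Id_on_def)
    moreover have "map_prod g g ` (carrier M \<times> carrier M) = carrier N \<times> carrier N"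
      using im by force
    ultimately show ?thesis by (elim disjE) simp_all
  qed
  then show ?thesis unfolding simple_smod_def by (intro conjI smod_iso_minimal[OF mM g] allI impI)
qed

lemma smod_iso_ann:
  assumes M: "smod S M" and g: "smod_iso S M N g"
  shows "ann S N = ann S M"
proof -
  have "carrier N = g ` carrier M" "inj_on g (carrier M)"
    using g by (simp_all add: smod_iso_def bij_betw_def)
  moreover have "act N (g m) s = g (act M m s)" if "m \<in> carrier M" "s \<in> carrier S" for m s
    using g that by (simp add: smod_iso_def)
  ultimately have "(\<forall>n\<in>carrier N. act N n s = act N n t) \<longleftrightarrow> (\<forall>m\<in>carrier M. act M m s = act M m t)"
    if "s \<in> carrier S" "t \<in> carrier S" for s t
    using that smod.act_closed[OF M] by (simp add: inj_on_eq_iff)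
  then show ?thesis unfolding ann_def by blast
qed

lemma smod_copy:
  fixes M :: "('a, 'm) smod" and g :: "'m \<Rightarrow> 'n"
  assumes M: "smod S M" and g: "inj_on g (carrier M)"
  shows "\<exists>N :: ('a, 'n) smod. smod_iso S M N g"
proof -
  let ?h = "inv_into (carrier M) g"
  let ?N = "\<lparr>carrier = g ` carrier M,
    mplus = (\<lambda>x y. g (mplus M (?h x) (?h y))),
    mzero = g (mzero M),
    act = (\<lambda>x s. g (act M (?h x) s))\<rparr> :: ('a, 'n) smod"
  have "smod_iso S M ?N g"
    using g by (simp add: smod_iso_def bij_betw_def)
  then show ?thesis by (rule exI)
qed

lemma minimal_smod_cyclic:
  assumes "minimal_smod S M"
  shows "\<exists>m\<in>carrier M. act M m ` carrier S = carrier M"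
proof -
  have sM: "smod S M" using assms by (simp add: minimal_smod_def)
  interpret smod S M by (rule sM)
  obtain m s where ms: "m \<in> carrier M" "s \<in> carrier S" "act M m s \<noteq> mzero M"
    using assms by (auto simp: minimal_smod_def)
  have z: "\<zero>\<^bsub>S\<^esub> \<in> carrier S"
    using monoid.one_closed[OF comm_monoid.axioms(1)[OF plus_comm_monoid]] by simp
  have "subsmod S M (act M m ` carrier S)"
    unfolding subsmod_def
  proof (intro conjI ballI)
    show "act M m ` carrier S \<subseteq> carrier M" using ms act_closed by blast
    show "mzero M \<in> act M m ` carrier S" using act_szero[OF ms(1)] z by (metis imageI)
    show "mplus M x y \<in> act M m ` carrier S"
      if "x \<in> act M m ` carrier S" "y \<in> act M m ` carrier S" for x y
      using that ms(1) srng_plus_closed[OF srng_axioms] by (auto simp flip: act_splus)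
    show "act M x t \<in> act M m ` carrier S"
      if "x \<in> act M m ` carrier S" "t \<in> carrier S" for x t
      using that ms(1) times_closed by (auto simp flip: act_stimes)
  qed
  then have "act M m ` carrier S = {mzero M} \<or> act M m ` carrier S = carrier M"
    using assms by (simp add: minimal_smod_def)
  then show ?thesis using ms by blast
qed

lemma minimal_smod_copy:
  fixes M :: "('a, 'm) smod"
  assumes "minimal_smod S M"
  shows "\<exists>(N :: ('a, 'a) smod) g. smod_iso S M N g"
proof -
  have sM: "smod S M" using assms by (simp add: minimal_smod_def)
  obtain m where "m \<in> carrier M" "act M m ` carrier S = carrier M"
    using minimal_smod_cyclic[OF assms] by blast
  then have "inj_on (inv_into (carrier S) (act M m)) (carrier M)"
    by (metis inj_on_inv_into order_refl)
  then show ?thesis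
    using smod_copy[OF sM] by blast
qed

theorem rad_m_subset_ann:
  fixes M :: "('a, 'm) smod"
  assumes "minimal_smod S M"
  shows "rad_m S \<subseteq> ann S M"
proof -
  obtain N :: "('a, 'a) smod" and g where g: "smod_iso S M N g"
    using minimal_smod_copy[OF assms] by blast
  have "rad_m S \<subseteq> ann S N"
    using smod_iso_minimal[OF assms g] by (auto simp: rad_m_def)
  then show ?thesis
    using smod_iso_ann[OF _ g] assms by (simp add: minimal_smod_def)
qed

theorem rad_s_subset_ann:
  fixes M :: "('a, 'm) smod"
  assumes "simple_smod S M"
  shows "rad_s S \<subseteq> ann S M"
proof -
  have mM: "minimal_smod S M" using assms by (simp add: simple_smod_def)
  obtain N :: "('a, 'a) smod" and g where g: "smod_iso S M N g"
    using minimal_smod_copy[OF mM] by blast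
  have "rad_s S \<subseteq> ann S N"
    using smod_iso_simple[OF assms g] by (auto simp: rad_s_def)
  then show ?thesis
    using smod_iso_ann[OF _ g] mM by (simp add: minimal_smod_def)
qed

end

theory Submission
  imports Defs
begin

text \<open>
  Both radicals are intersections of annihilators, and the proof rests on one observation. Let
  \<open>f : S \<rightarrow> T\<close> be a surjective homomorphism, and let \<open>M\<close> be an \<open>S\<close>-semimodule and \<open>N\<close> a
  \<open>T\<close>-semimodule on the same additive monoid, with \<open>m s = m f(s)\<close>. As \<open>f\<close> is surjective, the
  elements of \<open>S\<close> and those of \<open>T\<close> act through the same set of maps, so that \<open>M\<close> and \<open>N\<close> have
  the same subsemimodules and the same congruences (\<open>subsmod_iff\<close>, \<open>smod_congruence_iff\<close>). Hence
  \<open>M\<close> is minimal (simple) iff \<open>N\<close> is, and \<open>ann\<^sub>S(M)\<close> is the preimage of \<open>ann\<^sub>T(N)\<close>.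

  Every \<open>T\<close>-semimodule arises as such an \<open>N\<close>, by restriction of scalars. So \<open>(a, b)\<close> in the radical
  of \<open>S\<close> lies in the annihilators of all these restrictions, which says that \<open>(f(a), f(b))\<close> lies in
  the radical of \<open>T\<close>; this is (i).

  An \<open>S\<close>-semimodule \<open>M\<close> arises as such an \<open>M\<close> as soon as the kernel of \<open>f\<close> lies in \<open>ann\<^sub>S(M)\<close>, since
  the action then descends to \<open>T\<close>. If \<open>f\<close> is the projection of \<open>S\<close> onto its quotient by the
  radical, this applies to all minimal (simple) \<open>S\<close>-semimodules. So if \<open>(f(a), f(b))\<close> lies in the
  radical of the quotient, then \<open>(a, b)\<close> lies in the radical of \<open>S\<close>, that is, \<open>f(a) = f(b)\<close>; this is
  (ii).
\<close>

section \<open>Annihilators and the radicals as congruences\<close>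

lemma srng_zero_closed: "srng S \<Longrightarrow> \<zero>\<^bsub>S\<^esub> \<in> carrier S"
  using monoid.one_closed[OF comm_monoid.axioms(1)[OF srng.plus_comm_monoid[of S]]] by simp

text \<open>Compatibility with left multiplication is \<open>m (c a) = (m c) a\<close>: the element \<open>m c\<close> of \<open>M\<close> again
  does not distinguish \<open>a\<close> from \<open>b\<close>.\<close>

lemma ann_congruence:
  assumes "smod S M"
  shows "srng_congruence S (ann S M)"
proof -
  interpret smod S M by (rule assms)
  have "equiv (carrier S) (ann S M)"
    by (rule equivI) (auto simp: ann_def refl_on_def intro!: symI transI)
  then show ?thesis
    unfolding srng_congruence_def
    by (auto simp: ann_def act_splus act_stimes act_closed times_closed
        srng_plus_closed[OF srng_axioms])
qed

text \<open>The full relation accounts for the empty family, where \<open>\<Inter>R\<close> is the universal relation on the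
  type and may leave the carrier.\<close>

lemma srng_congruence_Inter:
  assumes S: "srng S" and R: "\<And>\<rho>. \<rho> \<in> R \<Longrightarrow> srng_congruence S \<rho>"
  shows "srng_congruence S ((carrier S \<times> carrier S) \<inter> \<Inter>R)"
proof -
  interpret srng S by (rule S)
  let ?\<sigma> = "(carrier S \<times> carrier S) \<inter> \<Inter>R"
  have eq: "equiv (carrier S) \<rho>" if "\<rho> \<in> R" for \<rho>
    using R[OF that] by (simp add: srng_congruence_def)
  have "equiv (carrier S) ?\<sigma>"
  proof (rule equivI)
    show "refl_on (carrier S) ?\<sigma>"
      using eq by (simp add: equiv_def refl_on_def)
    show "sym ?\<sigma>"
      using eq by (auto simp: equiv_def intro!: symI dest: symD)
    show "trans ?\<sigma>"
    proof (rule transI)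
      fix x y z assume xy: "(x, y) \<in> ?\<sigma>" and yz: "(y, z) \<in> ?\<sigma>"
      have "(x, z) \<in> \<rho>" if "\<rho> \<in> R" for \<rho>
        using eq[OF that] xy yz that unfolding equiv_def by (meson InterE IntD2 transD)
      then show "(x, z) \<in> ?\<sigma>" using xy yz by simp
    qed
  qed simp
  moreover have "(a \<oplus>\<^bsub>S\<^esub> c, b \<oplus>\<^bsub>S\<^esub> c) \<in> ?\<sigma> \<and> (a \<odot>\<^bsub>S\<^esub> c, b \<odot>\<^bsub>S\<^esub> c) \<in> ?\<sigma> \<and> (c \<odot>\<^bsub>S\<^esub> a, c \<odot>\<^bsub>S\<^esub> b) \<in> ?\<sigma>"
    if ab: "(a, b) \<in> ?\<sigma>" and c: "c \<in> carrier S" for a b c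
  proof -
    have "(a \<oplus>\<^bsub>S\<^esub> c, b \<oplus>\<^bsub>S\<^esub> c) \<in> \<rho> \<and> (a \<odot>\<^bsub>S\<^esub> c, b \<odot>\<^bsub>S\<^esub> c) \<in> \<rho> \<and> (c \<odot>\<^bsub>S\<^esub> a, c \<odot>\<^bsub>S\<^esub> b) \<in> \<rho>"
      if "\<rho> \<in> R" for \<rho>
    proof -
      have "(a, b) \<in> \<rho>" using ab that by simp
      then show ?thesis using R[OF that] c unfolding srng_congruence_def by fast
    qed
    then show ?thesis
      using ab c by (simp add: times_closed srng_plus_closed[OF S])
  qed
  ultimately show ?thesis
    unfolding srng_congruence_def by (simp only: Ball_def split_paired_All case_prod_conv) blast
qed

lemma rad_m_congruence: "srng S \<Longrightarrow> srng_congruence S (rad_m S)"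
  unfolding rad_m_def
  by (rule srng_congruence_Inter) (auto simp: minimal_smod_def intro: ann_congruence)

lemma rad_s_congruence: "srng S \<Longrightarrow> srng_congruence S (rad_s S)"
  unfolding rad_s_def
  by (rule srng_congruence_Inter)
    (auto simp: simple_smod_def minimal_smod_def intro: ann_congruence)

section \<open>Semimodules along a surjective homomorphism\<close>

locale surj_srng_hom = S: srng S + T: srng T
  for S :: "'a srng" and T :: "'b srng" +
  fixes f :: "'a \<Rightarrow> 'b"
  assumes hom: "f \<in> srng_hom S T"
    and surj: "f ` carrier S = carrier T"
begin

lemma map_closed: "a \<in> carrier S \<Longrightarrow> f a \<in> carrier T"
  using surj by blast

lemma map_plus: "\<lbrakk>a \<in> carrier S; b \<in> carrier S\<rbrakk> \<Longrightarrow> f (a \<oplus>\<^bsub>S\<^esub> b) = f a \<oplus>\<^bsub>T\<^esub> f b"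
  and map_times: "\<lbrakk>a \<in> carrier S; b \<in> carrier S\<rbrakk> \<Longrightarrow> f (a \<odot>\<^bsub>S\<^esub> b) = f a \<odot>\<^bsub>T\<^esub> f b"
  and map_zero: "f \<zero>\<^bsub>S\<^esub> = \<zero>\<^bsub>T\<^esub>"
  using hom by (simp_all add: srng_hom_def)

lemma ball_target_iff: "(\<forall>t\<in>carrier T. P t) \<longleftrightarrow> (\<forall>s\<in>carrier S. P (f s))"
  by (simp flip: surj)

text \<open>A relation and not restriction of scalars as a function: the same situation is reached from
  \<open>N\<close> by restricting scalars and from \<open>M\<close> by letting the action descend along \<open>f\<close>.\<close>

definition same_along :: "('a, 'm) smod \<Rightarrow> ('b, 'm) smod \<Rightarrow> bool" where
  "same_along M N \<longleftrightarrow> carrier M = carrier N \<and> mplus M = mplus N \<and> mzero M = mzero N \<and>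
     (\<forall>m\<in>carrier M. \<forall>s\<in>carrier S. act M m s = act N m (f s))"

lemma restrict_scalars:
  fixes N :: "('b, 'm) smod"
  shows "\<exists>M :: ('a, 'm) smod. same_along M N"
  by (rule exI[of _ "\<lparr>carrier = carrier N, mplus = mplus N, mzero = mzero N,
        act = (\<lambda>m s. act N m (f s))\<rparr>"]) (simp add: same_along_def)

text \<open>An element \<open>t\<close> of \<open>T\<close> acts as any of its preimages. They all act alike, by the hypothesis on
  the kernel, so the choice made by \<open>inv_into\<close> is immaterial.\<close>

lemma descend_action:
  fixes M :: "('a, 'm) smod"
  assumes ker: "\<And>a b. \<lbrakk>a \<in> carrier S; b \<in> carrier S; f a = f b\<rbrakk> \<Longrightarrow> (a, b) \<in> ann S M"
  shows "\<exists>N :: ('b, 'm) smod. same_along M N"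
proof -
  let ?h = "inv_into (carrier S) f"
  have "act M m s = act M m (?h (f s))" if "m \<in> carrier M" "s \<in> carrier S" for m s
  proof -
    have "f s \<in> f ` carrier S" using that by blast
    then have "(s, ?h (f s)) \<in> ann S M"
      by (intro ker that inv_into_into) (simp_all add: f_inv_into_f)
    then show ?thesis using that by (simp add: ann_def)
  qed
  then show ?thesis
    by (intro exI[of _ "\<lparr>carrier = carrier M, mplus = mplus M, mzero = mzero M,
        act = (\<lambda>m t. act M m (?h t))\<rparr>"]) (simp add: same_along_def)
qed

context
  fixes M :: "('a, 'm) smod" and N :: "('b, 'm) smod"
  assumes same: "same_along M N"
begin

lemma same_carrier: "carrier N = carrier M"
  and same_plus: "mplus N = mplus M"
  and same_zero: "mzero N = mzero M"
  and same_act: "\<lbrakk>m \<in> carrier M; s \<in> carrier S\<rbrakk> \<Longrightarrow> act N m (f s) = act M m s"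
  using same by (simp_all add: same_along_def)

lemma smod_iff: "smod S M \<longleftrightarrow> smod T N"
proof
  assume M: "smod S M"
  interpret smod S M by (rule M)
  show "smod T N"
  proof (intro smod.intro T.srng_axioms smod_axioms.intro)
    show "comm_monoid \<lparr>carrier = carrier N, monoid.mult = mplus N, one = mzero N\<rparr>"
      using mplus_comm_monoid by (simp add: same_carrier same_plus same_zero)
  qed (auto simp: same_carrier same_plus same_zero same_act act_closed mplus_act act_splus
      act_stimes act_szero mzero_act smod_plus_closed[OF M] smod_zero_closed[OF M]
      srng_plus_closed[OF S.srng_axioms] srng_zero_closed[OF S.srng_axioms] S.times_closed
      simp flip: surj map_plus map_times map_zero)
next
  assume N: "smod T N"
  interpret smod T N by (rule N)
  have cl: "act N m (f s) \<in> carrier M" if "m \<in> carrier M" "s \<in> carrier S" for m s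
    using act_closed[of m "f s"] that map_closed by (simp add: same_carrier)
  show "smod S M"
  proof (intro smod.intro S.srng_axioms smod_axioms.intro)
    show "comm_monoid \<lparr>carrier = carrier M, monoid.mult = mplus M, one = mzero M\<rparr>"
      using mplus_comm_monoid by (simp add: same_carrier same_plus same_zero)
  qed (use mplus_act act_splus act_stimes act_szero mzero_act smod_plus_closed[OF N]
      smod_zero_closed[OF N] srng_plus_closed[OF S.srng_axioms]
      srng_zero_closed[OF S.srng_axioms] S.times_closed
      in \<open>simp_all add: same_carrier same_plus same_zero cl map_closed map_plus map_times map_zero
        flip: same_act\<close>)
qed

text \<open>Since \<open>f\<close> is onto, quantifying over the action of \<open>T\<close> is quantifying over that of \<open>S\<close>. This is
  the reason for the next four equivalences.\<close>

lemma subsmod_iff: "subsmod S M K \<longleftrightarrow> subsmod T N K"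
proof -
  have "(\<forall>m\<in>K. \<forall>t\<in>carrier T. act N m t \<in> K) \<longleftrightarrow> (\<forall>m\<in>K. \<forall>s\<in>carrier S. act M m s \<in> K)"
    if "K \<subseteq> carrier M"
    using that by (simp add: ball_target_iff same_act subset_iff)
  then show ?thesis
    unfolding subsmod_def same_carrier same_plus same_zero by blast
qed

lemma smod_congruence_iff: "smod_congruence S M \<theta> \<longleftrightarrow> smod_congruence T N \<theta>"
proof -
  have "(\<forall>(m, n)\<in>\<theta>. \<forall>t\<in>carrier T. (act N m t, act N n t) \<in> \<theta>) \<longleftrightarrow>
      (\<forall>(m, n)\<in>\<theta>. \<forall>s\<in>carrier S. (act M m s, act M n s) \<in> \<theta>)"
    if "equiv (carrier M) \<theta>"
  proof -
    have "m \<in> carrier M \<and> n \<in> carrier M" if "(m, n) \<in> \<theta>" for m n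
      using \<open>equiv (carrier M) \<theta>\<close> that by (auto simp: equiv_def)
    then show ?thesis
      by (auto simp: ball_target_iff same_act)
  qed
  then show ?thesis
    unfolding smod_congruence_def same_carrier same_plus by blast
qed

lemma minimal_smod_iff: "minimal_smod S M \<longleftrightarrow> minimal_smod T N"
proof -
  have "(\<exists>m\<in>carrier N. \<exists>t\<in>carrier T. act N m t \<noteq> mzero N) \<longleftrightarrow>
      (\<exists>m\<in>carrier M. \<exists>s\<in>carrier S. act M m s \<noteq> mzero M)"
    by (simp add: same_carrier same_zero same_act flip: surj)
  then show ?thesis
    unfolding minimal_smod_def by (simp only: smod_iff subsmod_iff same_carrier same_zero)
qed

lemma simple_smod_iff: "simple_smod S M \<longleftrightarrow> simple_smod T N"
  unfolding simple_smod_def by (simp add: minimal_smod_iff smod_congruence_iff same_carrier)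

lemma ann_iff:
  assumes "a \<in> carrier S" "b \<in> carrier S"
  shows "(f a, f b) \<in> ann T N \<longleftrightarrow> (a, b) \<in> ann S M"
  using assms by (simp add: ann_def same_carrier same_act map_closed)

end

section \<open>Comparing the radicals of source and target\<close>

text \<open>The restriction \<open>M\<close> of \<open>N\<close> lives on the element type of \<open>T\<close>, outside the family that defines
  the radical of \<open>S\<close>; \<open>rad_m_subset_ann\<close> bridges the two types. The descended semimodule in
  \<open>rad_m_reflect\<close> lives on the element type of \<open>S\<close> and is handled in the same way.\<close>

lemma rad_m_image:
  assumes ab: "(a, b) \<in> rad_m S"
  shows "(f a, f b) \<in> rad_m T"
proof -
  have c: "a \<in> carrier S" "b \<in> carrier S" using ab by (auto simp: rad_m_def)
  have "(f a, f b) \<in> ann T N" if N: "minimal_smod T N" for N :: "('b, 'b) smod"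
  proof -
    obtain M :: "('a, 'b) smod" where MN: "same_along M N" using restrict_scalars by blast
    have "rad_m S \<subseteq> ann S M"
      using rad_m_subset_ann minimal_smod_iff[OF MN] N by blast
    then show ?thesis using ann_iff[OF MN c] ab by blast
  qed
  then show ?thesis using c by (simp add: rad_m_def map_closed)
qed

lemma rad_s_image:
  assumes ab: "(a, b) \<in> rad_s S"
  shows "(f a, f b) \<in> rad_s T"
proof -
  have c: "a \<in> carrier S" "b \<in> carrier S" using ab by (auto simp: rad_s_def)
  have "(f a, f b) \<in> ann T N" if N: "simple_smod T N" for N :: "('b, 'b) smod"
  proof -
    obtain M :: "('a, 'b) smod" where MN: "same_along M N" using restrict_scalars by blast
    have "rad_s S \<subseteq> ann S M"
      using rad_s_subset_ann simple_smod_iff[OF MN] N by blast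
    then show ?thesis using ann_iff[OF MN c] ab by blast
  qed
  then show ?thesis using c by (simp add: rad_s_def map_closed)
qed

text \<open>A kernel inside the radical annihilates every minimal \<open>S\<close>-semimodule, so all of them come from
  \<open>T\<close> and are seen by the radical of \<open>T\<close>.\<close>

lemma rad_m_reflect:
  assumes ker: "\<And>a b. \<lbrakk>a \<in> carrier S; b \<in> carrier S; f a = f b\<rbrakk> \<Longrightarrow> (a, b) \<in> rad_m S"
    and c: "a \<in> carrier S" "b \<in> carrier S" and fab: "(f a, f b) \<in> rad_m T"
  shows "(a, b) \<in> rad_m S"
proof -
  have "(a, b) \<in> ann S M" if M: "minimal_smod S M" for M :: "('a, 'a) smod"
  proof -
    obtain N :: "('b, 'a) smod" where MN: "same_along M N"
      using descend_action ker rad_m_subset_ann[OF M] by blast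
    have "rad_m T \<subseteq> ann T N"
      using rad_m_subset_ann minimal_smod_iff[OF MN] M by blast
    then show ?thesis using ann_iff[OF MN c] fab by blast
  qed
  then show ?thesis using c by (simp add: rad_m_def)
qed

lemma rad_s_reflect:
  assumes ker: "\<And>a b. \<lbrakk>a \<in> carrier S; b \<in> carrier S; f a = f b\<rbrakk> \<Longrightarrow> (a, b) \<in> rad_s S"
    and c: "a \<in> carrier S" "b \<in> carrier S" and fab: "(f a, f b) \<in> rad_s T"
  shows "(a, b) \<in> rad_s S"
proof -
  have "(a, b) \<in> ann S M" if M: "simple_smod S M" for M :: "('a, 'a) smod"
  proof -
    obtain N :: "('b, 'a) smod" where MN: "same_along M N"
      using descend_action ker rad_s_subset_ann[OF M] by blast
    have "rad_s T \<subseteq> ann T N"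
      using rad_s_subset_ann simple_smod_iff[OF MN] M by blast
    then show ?thesis using ann_iff[OF MN c] fab by blast
  qed
  then show ?thesis using c by (simp add: rad_s_def)
qed

end

section \<open>The quotient by the radical\<close>

lemma srng_quot_srng:
  assumes S: "srng S" and \<rho>: "srng_congruence S \<rho>"
  shows "srng (srng_quot S \<rho>)"
proof -
  interpret srng S by (rule S)
  let ?Q = "srng_quot S \<rho>"
  have car: "carrier ?Q = (\<lambda>a. \<rho> `` {a}) ` carrier S"
    by (auto simp: srng_quot_def quotient_def)
  have z: "\<zero>\<^bsub>?Q\<^esub> = \<rho> `` {\<zero>\<^bsub>S\<^esub>}" by (simp add: srng_quot_def)
  interpret add: comm_monoid "\<lparr>carrier = carrier S, monoid.mult = splus S, one = szero S\<rparr>"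
    by (rule plus_comm_monoid)
  note cl = srng_plus_closed[OF S] srng_zero_closed[OF S] times_closed
  note quot = srng_quot_plus[OF S \<rho>] srng_quot_times[OF \<rho>]
  have "comm_monoid \<lparr>carrier = carrier ?Q, monoid.mult = splus ?Q, one = szero ?Q\<rparr>"
  proof (rule comm_monoidI, goal_cases)
    case (5 x y)
    then show ?case using add.m_comm by (auto simp: car quot)
  qed (use add.m_assoc add.l_one in \<open>auto simp: car quot cl z\<close>)
  then show ?thesis
    by (intro srng.intro)
      (auto simp: car quot cl z times_assoc distrib_left distrib_right zero_times times_zero)
qed

lemma srng_quot_surj_hom:
  assumes S: "srng S" and \<rho>: "srng_congruence S \<rho>"
  shows "surj_srng_hom S (srng_quot S \<rho>) (\<lambda>a. \<rho> `` {a})"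
proof (intro surj_srng_hom.intro surj_srng_hom_axioms.intro S srng_quot_srng[OF S \<rho>])
  show *: "(\<lambda>a. \<rho> `` {a}) ` carrier S = carrier (srng_quot S \<rho>)"
    by (auto simp: srng_quot_def quotient_def)
  have "\<zero>\<^bsub>srng_quot S \<rho>\<^esub> = \<rho> `` {\<zero>\<^bsub>S\<^esub>}" by (simp add: srng_quot_def)
  then show "(\<lambda>a. \<rho> `` {a}) \<in> srng_hom S (srng_quot S \<rho>)"
    by (auto simp: srng_hom_def srng_quot_plus[OF S \<rho>] srng_quot_times[OF \<rho>] simp flip: *)
qed

text \<open>The congruences on a quotient by \<open>\<rho>\<close> correspond to the congruences above \<open>\<rho>\<close>, and equality
  corresponds to \<open>\<rho>\<close> itself. So it suffices that the preimage of \<open>\<sigma>\<close> is not larger than \<open>\<rho>\<close>.\<close>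

lemma srng_quot_congruence_trivial:
  assumes S: "srng S" and \<rho>: "srng_congruence S \<rho>"
    and \<sigma>: "srng_congruence (srng_quot S \<rho>) \<sigma>"
    and reflect: "\<And>a b. \<lbrakk>a \<in> carrier S; b \<in> carrier S; (\<rho> `` {a}, \<rho> `` {b}) \<in> \<sigma>\<rbrakk> \<Longrightarrow> (a, b) \<in> \<rho>"
  shows "\<sigma> = Id_on (carrier (srng_quot S \<rho>))"
proof -
  have eq: "equiv (carrier S) \<rho>" using \<rho> by (simp add: srng_congruence_def)
  have eq': "equiv (carrier (srng_quot S \<rho>)) \<sigma>" using \<sigma> by (simp add: srng_congruence_def)
  have "X = Y" if XY: "(X, Y) \<in> \<sigma>" for X Y
  proof -
    have "X \<in> carrier S // \<rho>" "Y \<in> carrier S // \<rho>"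
      using eq' XY by (auto simp: equiv_def srng_quot_def)
    then obtain a b where "a \<in> carrier S" "b \<in> carrier S" "X = \<rho> `` {a}" "Y = \<rho> `` {b}"
      by (auto elim!: quotientE)
    then show ?thesis using reflect XY equiv_class_eq[OF eq] by blast
  qed
  then show ?thesis using eq' by (fastforce simp: equiv_def refl_on_def)
qed

lemma rad_m_quot:
  assumes S: "srng S"
  shows "rad_m (srng_quot S (rad_m S)) = Id_on (carrier (srng_quot S (rad_m S)))"
proof -
  note cong = rad_m_congruence[OF S]
  have "equiv (carrier S) (rad_m S)" using cong by (simp add: srng_congruence_def)
  then have ker: "(a, b) \<in> rad_m S"
    if "a \<in> carrier S" "b \<in> carrier S" "rad_m S `` {a} = rad_m S `` {b}" for a b
    using that eq_equiv_class by fast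
  show ?thesis
    by (rule srng_quot_congruence_trivial[OF S cong rad_m_congruence[OF srng_quot_srng[OF S cong]]])
      (rule surj_srng_hom.rad_m_reflect[OF srng_quot_surj_hom[OF S cong] ker])
qed

lemma rad_s_quot:
  assumes S: "srng S"
  shows "rad_s (srng_quot S (rad_s S)) = Id_on (carrier (srng_quot S (rad_s S)))"
proof -
  note cong = rad_s_congruence[OF S]
  have "equiv (carrier S) (rad_s S)" using cong by (simp add: srng_congruence_def)
  then have ker: "(a, b) \<in> rad_s S"
    if "a \<in> carrier S" "b \<in> carrier S" "rad_s S `` {a} = rad_s S `` {b}" for a b
    using that eq_equiv_class by fast
  show ?thesis
    by (rule srng_quot_congruence_trivial[OF S cong rad_s_congruence[OF srng_quot_srng[OF S cong]]])
      (rule surj_srng_hom.rad_s_reflect[OF srng_quot_surj_hom[OF S cong] ker])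
qed

theorem theorem3p3:
  fixes S :: "'a srng"
  assumes "srng S"
  shows
    "(srng_congruence S (rad_m S) \<and>
      (\<forall>(T :: 'b srng) f. srng T \<and> f \<in> srng_hom S T \<and> f ` carrier S = carrier T \<longrightarrow>
         {(f a, f b) | a b. (a, b) \<in> rad_m S} \<subseteq> rad_m T) \<and>
      rad_m (srng_quot S (rad_m S)) = Id_on (carrier (srng_quot S (rad_m S)))) \<and>
     (srng_congruence S (rad_s S) \<and>
      (\<forall>(T :: 'b srng) f. srng T \<and> f \<in> srng_hom S T \<and> f ` carrier S = carrier T \<longrightarrow>
         {(f a, f b) | a b. (a, b) \<in> rad_s S} \<subseteq> rad_s T) \<and>
      rad_s (srng_quot S (rad_s S)) = Id_on (carrier (srng_quot S (rad_s S))))"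
proof -
  have hom: "surj_srng_hom S T f"
    if "srng T \<and> f \<in> srng_hom S T \<and> f ` carrier S = carrier T" for T :: "'b srng" and f
    using assms that by (simp add: surj_srng_hom_def surj_srng_hom_axioms_def)
  have "{(f a, f b) | a b. (a, b) \<in> rad_m S} \<subseteq> rad_m T"
    "{(f a, f b) | a b. (a, b) \<in> rad_s S} \<subseteq> rad_s T"
    if "srng T \<and> f \<in> srng_hom S T \<and> f ` carrier S = carrier T" for T :: "'b srng" and f
    using surj_srng_hom.rad_m_image[OF hom[OF that]] surj_srng_hom.rad_s_image[OF hom[OF that]]
    by blast+
  then show ?thesis
    using rad_m_congruence[OF assms] rad_s_congruence[OF assms] rad_m_quot[OF assms]
      rad_s_quot[OF assms] by simp
qed

end
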